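(* Let $G$ be a group acting uniformly properly on an injective metric space $X$. Infinite-order elements of $G$ are uniformly undistorted. Moreover, every infinite-order $g\in G$ admits an $\varepsilon$-quasi-axis in $X$ for every $\varepsilon>0$.
   Context: All actions of groups on metric spaces are by isometries. A metric space $X$ is injective if for every metric space $B$ and every subset $A\subseteq B$, every 1-Lipschitz map $f\colon A\to X$ extends to a 1-Lipschitz map $\hat f\colon B\to X$ with $\hat f|_A=f$. An action of $G$ on $(X,\mathsf d)$ is uniformly proper if for every $\varepsilon>0$ there exists $N$ such that $|\{g\in G : \mathsf d(x,gx)\le\varepsilon\}|\le N$ for all $x\in X$. Uniform undistortion refers to a finitely generated group $G$ with a word metric $\mathsf d_G$. For $g\in G$, the (stable) translation length is $\tau_G(g)=\lim_{n\to\infty}\frac1n\mathsf d_G(x,g^nx)$, which is independent of $x\in G$. If $\tau_G(g)>0$, then $g$ has infinite order and the inclusion of $\langle g\rangle$ in $G$ is a quasi-isometric embedding; one says that $g$ (or $\langle g\rangle$) is undistorted. Infinite-order elements of $G$ are uniformly undistorted if there exists $\tau_0>0$ such that $\tau_G(g)\ge\tau_0$ for every infinite-order $g\in G$. For $q\ge0$, a $q$-quasi-axis of an isometry $g$ of $X$ is a $\langle g\rangle$-invariant subset $A_g\subseteq X$ admitting a $q$-coarsely surjective $(1+q,q)$-quasi-isometry $f\colon\mathbb R\to A_g$, i.e. $\frac1{1+q}|s-t|-q\le \mathsf d(f(s),f(t))\le(1+q)|s-t|+q$ for all $s,t\in\mathbb R$, and every point of $A_g$ is within distance $q$ of $f(\mathbb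 R)$. *)

theory Defs
  imports
    "HOL-Algebra.Generated_Groups"
    "HOL-Algebra.Group_Action"
    "HOL-Algebra.Multiplicative_Group"
    "HOL-Analysis.Abstract_Metric_Spaces"
begin

section \<open>Injective metric spaces\<close>

definition one_lipschitz_map ::
  "'a set \<Rightarrow> ('a \<Rightarrow> 'a \<Rightarrow> real) \<Rightarrow> 'b set \<Rightarrow> ('b \<Rightarrow> 'b \<Rightarrow> real) \<Rightarrow> ('a \<Rightarrow> 'b) \<Rightarrow> bool" where
  "one_lipschitz_map A dA Y dY f \<longleftrightarrow>
     f \<in> A \<rightarrow> Y \<and> (\<forall>a\<in>A. \<forall>a'\<in>A. dY (f a) (f a') \<le> dA a a')"

text \<open>
  The extension property defining injectivity, for all metric spaces \<open>B\<close> whose points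
  have the type \<open>'b\<close>.  The quantification over all metric spaces is a quantification over
  all types \<open>'b\<close>, which cannot occur inside a definition.
\<close>

definition injective_for :: "'b itself \<Rightarrow> 'a set \<Rightarrow> ('a \<Rightarrow> 'a \<Rightarrow> real) \<Rightarrow> bool" where
  "injective_for _ X d \<longleftrightarrow>
     Metric_space X d \<and>
     (\<forall>(B :: 'b set) dB A f.
        Metric_space B dB \<longrightarrow> A \<subseteq> B \<longrightarrow> one_lipschitz_map A dB X d f \<longrightarrow>
        (\<exists>f'. one_lipschitz_map B dB X d f' \<and> (\<forall>a\<in>A. f' a = f a)))"

text \<open>
  It suffices to let \<open>B\<close> range over the metric spaces on the type \<open>'a option\<close>, where
  \<open>'a\<close> is the type of the points of \<open>X\<close>: theorem \<open>injective_metric_space_extension\<close>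
  below gives the extension property for metric spaces on an arbitrary type.
\<close>

definition injective_metric_space :: "'a set \<Rightarrow> ('a \<Rightarrow> 'a \<Rightarrow> real) \<Rightarrow> bool" where
  "injective_metric_space X d \<longleftrightarrow> injective_for TYPE('a option) X d"

lemma injective_metric_space_nonempty:
  assumes "injective_metric_space X d"
  shows "X \<noteq> {}"
proof -
  have "Metric_space {None} (\<lambda>(x::'a option) (y::'a option). 0::real)"
    by unfold_locales auto
  moreover have "one_lipschitz_map {} (\<lambda>(x::'a option) (y::'a option). 0::real) X d (\<lambda>_. undefined)"
    by (simp add: one_lipschitz_map_def)
  ultimately obtain f' where
    "one_lipschitz_map {None :: 'a option} (\<lambda>(x::'a option) (y::'a option). 0::real) X d f'"
    using assms unfolding injective_metric_space_def injective_for_def by blast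
  thus ?thesis by (auto simp: one_lipschitz_map_def)
qed

lemma injective_metric_space_point:
  assumes inj: "injective_metric_space X d"
    and r0: "\<And>x. x \<in> X \<Longrightarrow> 0 \<le> r x"
    and r1: "\<And>x y. x \<in> X \<Longrightarrow> y \<in> X \<Longrightarrow> r x \<le> d x y + r y"
    and r2: "\<And>x y. x \<in> X \<Longrightarrow> y \<in> X \<Longrightarrow> d x y \<le> r x + r y"
  shows "\<exists>z\<in>X. \<forall>x\<in>X. d z x \<le> r x"
proof (cases "\<exists>z\<in>X. r z = 0")
  case True
  thus ?thesis using r2 by force
next
  case False
  interpret X: Metric_space X d
    using inj by (simp add: injective_metric_space_def injective_for_def)
  define dB where "dB = (\<lambda>p q. case (p, q) of
      (None, None) \<Rightarrow> 0 | (None, Some y) \<Rightarrow> \<bar>r y\<bar>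
    | (Some x, None) \<Rightarrow> \<bar>r x\<bar> | (Some x, Some y) \<Rightarrow> d x y)"
  let ?B = "insert None (Some ` X)"
  have "Metric_space ?B dB"
  proof
    fix p q :: "'a option"
    show "0 \<le> dB p q" "dB p q = dB q p"
      by (auto simp: dB_def X.commute split: option.splits)
    show "dB p q = 0 \<longleftrightarrow> p = q" if "p \<in> ?B" "q \<in> ?B"
      using that False by (auto simp: dB_def)
    fix s assume "p \<in> ?B" "q \<in> ?B" "s \<in> ?B"
    thus "dB p s \<le> dB p q + dB q s"
      using r0 r1 r2 X.commute X.triangle
      by (auto simp: dB_def abs_of_nonneg add.commute) (metis add.commute)+
  qed
  moreover have "one_lipschitz_map (Some ` X) dB X d the"
    by (auto simp: one_lipschitz_map_def dB_def)
  ultimately obtain f' where f': "one_lipschitz_map ?B dB X d f'" "\<forall>a\<in>Some ` X. f' a = the a"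
    using inj unfolding injective_metric_space_def injective_for_def by blast
  have "d (f' None) x \<le> r x" if "x \<in> X" for x
  proof -
    have "d (f' None) (f' (Some x)) \<le> dB None (Some x)"
      using f'(1) that unfolding one_lipschitz_map_def by blast
    thus ?thesis using f'(2) that r0 by (simp add: dB_def)
  qed
  moreover have "f' None \<in> X" using f'(1) by (auto simp: one_lipschitz_map_def)
  ultimately show ?thesis by blast
qed

lemma injective_metric_space_extend_point:
  assumes inj: "injective_metric_space X d"
    and B: "Metric_space B dB" and C: "C \<subseteq> B" and b: "b \<in> B"
    and h: "one_lipschitz_map C dB X d h"
  shows "\<exists>z\<in>X. \<forall>c\<in>C. d z (h c) \<le> dB b c"
proof (cases "C = {}")
  case True
  thus ?thesis using injective_metric_space_nonempty[OF inj] by blast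
next
  case False
  interpret X: Metric_space X d
    using inj by (simp add: injective_metric_space_def injective_for_def)
  interpret B: Metric_space B dB by (rule B)
  have hX: "h c \<in> X" if "c \<in> C" for c using h that by (auto simp: one_lipschitz_map_def)
  have hL: "d (h c) (h c') \<le> dB c c'" if "c \<in> C" "c' \<in> C" for c c'
    using h that by (auto simp: one_lipschitz_map_def)
  define r where "r x = (INF c\<in>C. dB b c + d (h c) x)" for x
  have bdd: "bdd_below ((\<lambda>c. dB b c + d (h c) x) ` C)" for x
    by (rule bdd_belowI2[where m = 0]) simp
  have le: "r x \<le> dB b c + d (h c) x" if "c \<in> C" for c x
    unfolding r_def using bdd that by (rule cINF_lower)
  have ge: "t \<le> r x" if "\<And>c. c \<in> C \<Longrightarrow> t \<le> dB b c + d (h c) x" for t x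
    unfolding r_def using False that by (rule cINF_greatest)
  have "\<exists>z\<in>X. \<forall>x\<in>X. d z x \<le> r x"
  proof (rule injective_metric_space_point[OF inj])
    show "0 \<le> r x" for x by (rule ge) simp
    fix x y assume xy: "x \<in> X" "y \<in> X"
    have "r x - d x y \<le> r y"
    proof (rule ge)
      fix c assume c: "c \<in> C"
      show "r x - d x y \<le> dB b c + d (h c) y"
        using le[OF c, of x] X.triangle[OF hX[OF c] xy(2) xy(1)] X.commute[of x y] by linarith
    qed
    thus "r x \<le> d x y + r y" by simp
    have "d x y - r x \<le> r y"
    proof (rule ge)
      fix c assume c: "c \<in> C"
      have "d x y - (dB b c + d (h c) y) \<le> r x"
      proof (rule ge)
        fix c' assume c': "c' \<in> C"
        have "d x y \<le> d x (h c') + d (h c') (h c) + d (h c) y"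
          using X.triangle[OF xy(1) hX[OF c'] xy(2)] X.triangle[OF hX[OF c'] hX[OF c] xy(2)]
          by linarith
        moreover have "d (h c') (h c) \<le> dB b c' + dB b c"
          using hL[OF c' c] B.triangle[of c' b c] C b c c' B.commute[of c' b] by force
        ultimately show "d x y - (dB b c + d (h c) y) \<le> dB b c' + d (h c') x"
          using X.commute[of x "h c'"] by linarith
      qed
      thus "d x y - r x \<le> dB b c + d (h c) y" by linarith
    qed
    thus "d x y \<le> r x + r y" by simp
  qed
  then obtain z where z: "z \<in> X" "\<And>x. x \<in> X \<Longrightarrow> d z x \<le> r x" by blast
  have "d z (h c) \<le> dB b c" if "c \<in> C" for c
    using z(2)[OF hX[OF that]] le[OF that, of "h c"] X.mdist_zero[OF hX[OF that]] by linarith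
  thus ?thesis using z(1) by blast
qed

theorem injective_metric_space_extension:
  fixes X :: "'a set"
  assumes inj: "injective_metric_space X d"
  shows "injective_for TYPE('b) X d"
  unfolding injective_for_def
proof (intro conjI allI impI)
  show XM: "Metric_space X d"
    using inj by (simp add: injective_metric_space_def injective_for_def)
  interpret X: Metric_space X d by (rule XM)
  fix B :: "'b set" and dB A f
  assume B: "Metric_space B dB" and AB: "A \<subseteq> B" and f: "one_lipschitz_map A dB X d f"
  interpret B: Metric_space B dB by (rule B)
  define good where "good R \<longleftrightarrow> R \<subseteq> B \<times> X \<and>
      (\<forall>(b, x)\<in>R. \<forall>(b', x')\<in>R. d x x' \<le> dB b b')" for R
  let ?R0 = "(\<lambda>a. (a, f a)) ` A"
  let ?F = "{R. good R \<and> ?R0 \<subseteq> R}"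
  have "\<exists>R\<in>?F. \<forall>S\<in>?F. R \<subseteq> S \<longrightarrow> S = R"
  proof (rule subset_Zorn_nonempty)
    have "good ?R0"
      using f AB by (auto simp: good_def one_lipschitz_map_def)
    thus "?F \<noteq> {}" by blast
    fix \<C> assume ne: "\<C> \<noteq> {}" and ch: "subset.chain ?F \<C>"
    hence sub: "\<C> \<subseteq> ?F" and lin: "\<And>R S. R \<in> \<C> \<Longrightarrow> S \<in> \<C> \<Longrightarrow> R \<subseteq> S \<or> S \<subseteq> R"
      by (auto simp: subset_chain_def)
    have UL: "d x x' \<le> dB b b'" if bx: "(b, x) \<in> \<Union>\<C>" and bx': "(b', x') \<in> \<Union>\<C>" for b x b' x'
    proof -
      obtain R S where RS: "R \<in> \<C>" "S \<in> \<C>" "(b, x) \<in> R" "(b', x') \<in> S" using bx bx' by blast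
      obtain T where "T \<in> \<C>" "(b, x) \<in> T" "(b', x') \<in> T" using lin[OF RS(1,2)] RS by blast
      thus ?thesis using sub by (fastforce simp: good_def)
    qed
    have "\<Union>\<C> \<subseteq> B \<times> X" using sub unfolding good_def by blast
    hence "good (\<Union>\<C>)" unfolding good_def by (intro conjI ballI) (auto intro!: UL simp del: Union_iff)
    thus "\<Union>\<C> \<in> ?F" using ne sub by blast
  qed
  then obtain R where RF: "R \<in> ?F" and RM: "\<forall>S\<in>?F. R \<subseteq> S \<longrightarrow> S = R" ..
  have R: "good R" "?R0 \<subseteq> R" using RF by simp_all
  have max: "S = R" if "good S" "R \<subseteq> S" for S
    using RM that subset_trans[OF R(2) that(2)] by simp
  have RBX: "b \<in> B" "x \<in> X" if "(b, x) \<in> R" for b x using R(1) that by (auto simp: good_def)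
  have RL: "d x x' \<le> dB b b'" if "(b, x) \<in> R" "(b', x') \<in> R" for b x b' x'
    using R(1) that by (fastforce simp: good_def)
  have single: "x = x'" if "(b, x) \<in> R" "(b, x') \<in> R" for b x x'
    using RL[OF that] RBX[OF that(1)] RBX[OF that(2)] by (metis B.mdist_zero X.nonneg X.zero antisym)
  define h where "h b = (SOME x. (b, x) \<in> R)" for b
  have h: "(b, h b) \<in> R" if "b \<in> Domain R" for b
    unfolding h_def using that by (metis DomainE someI)
  have total: "b \<in> Domain R" if b: "b \<in> B" for b
  proof -
    have "one_lipschitz_map (Domain R) dB X d h"
      unfolding one_lipschitz_map_def using RBX(2)[OF h] RL[OF h h] by auto
    from injective_metric_space_extend_point[OF inj B _ b this] RBX(1)
    obtain z where z: "z \<in> X" "\<forall>c\<in>Domain R. d z (h c) \<le> dB b c"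
      by (metis DomainE subsetI)
    have zR: "d z x \<le> dB b c" "d x z \<le> dB c b" if "(c, x) \<in> R" for c x
    proof -
      have "c \<in> Domain R" using that by blast
      moreover from this have "h c = x" using single[OF h that] by blast
      ultimately show "d z x \<le> dB b c" using z(2) by blast
      thus "d x z \<le> dB c b" by (metis X.commute B.commute)
    qed
    have "good (insert (b, z) R)"
      unfolding good_def using b z(1) zR RBX RL X.mdist_zero[OF z(1)] by auto
    hence "insert (b, z) R = R" by (rule max) (rule subset_insertI)
    hence "(b, z) \<in> R" by (metis insertI1)
    thus ?thesis by (rule DomainI)
  qed
  have "one_lipschitz_map B dB X d h"
    unfolding one_lipschitz_map_def using RBX(2)[OF h] RL[OF h h] total by auto
  moreover have "h a = f a" if "a \<in> A" for a
  proof -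
    have "(a, f a) \<in> R" using R(2) that by blast
    thus ?thesis using single[OF h] by blast
  qed
  ultimately show "\<exists>f'. one_lipschitz_map B dB X d f' \<and> (\<forall>a\<in>A. f' a = f a)" by blast
qed


section \<open>Isometric and uniformly proper actions\<close>

definition isometric_action ::
  "('g, 'm) monoid_scheme \<Rightarrow> 'a set \<Rightarrow> ('a \<Rightarrow> 'a \<Rightarrow> real) \<Rightarrow> ('g \<Rightarrow> 'a \<Rightarrow> 'a) \<Rightarrow> bool" where
  "isometric_action G X d \<phi> \<longleftrightarrow>
     group_action G X \<phi> \<and>
     (\<forall>g\<in>carrier G. \<forall>x\<in>X. \<forall>y\<in>X. d (\<phi> g x) (\<phi> g y) = d x y)"

definition uniformly_proper ::
  "('g, 'm) monoid_scheme \<Rightarrow> 'a set \<Rightarrow> ('a \<Rightarrow> 'a \<Rightarrow> real) \<Rightarrow> ('g \<Rightarrow> 'a \<Rightarrow> 'a) \<Rightarrow> bool" where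
  "uniformly_proper G X d \<phi> \<longleftrightarrow>
     (\<forall>\<epsilon>>0. \<exists>N::nat. \<forall>x\<in>X.
        finite {g \<in> carrier G. d x (\<phi> g x) \<le> \<epsilon>} \<and>
        card {g \<in> carrier G. d x (\<phi> g x) \<le> \<epsilon>} \<le> N)"

text \<open>For \<open>g \<in> carrier G\<close>, the library's \<open>ord\<close> is 0 exactly if \<open>g\<close> has infinite order.\<close>

definition infinite_order :: "('g, 'm) monoid_scheme \<Rightarrow> 'g \<Rightarrow> bool" where
  "infinite_order G g \<longleftrightarrow> g \<in> carrier G \<and> group.ord G g = 0"


section \<open>Word metrics and uniform undistortion\<close>

definition finite_generating_set :: "('g, 'm) monoid_scheme \<Rightarrow> 'g set \<Rightarrow> bool" where
  "finite_generating_set G S \<longleftrightarrow> finite S \<and> S \<subseteq> carrier G \<and> generate G S = carrier G"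

definition word_length :: "('g, 'm) monoid_scheme \<Rightarrow> 'g set \<Rightarrow> 'g \<Rightarrow> nat" where
  "word_length G S g =
     (LEAST n. \<exists>ws. length ws = n \<and> set ws \<subseteq> S \<union> (\<lambda>s. inv\<^bsub>G\<^esub> s) ` S \<and>
                    foldr (\<lambda>a b. a \<otimes>\<^bsub>G\<^esub> b) ws \<one>\<^bsub>G\<^esub> = g)"

definition word_metric :: "('g, 'm) monoid_scheme \<Rightarrow> 'g set \<Rightarrow> 'g \<Rightarrow> 'g \<Rightarrow> real" where
  "word_metric G S x y = real (word_length G S (inv\<^bsub>G\<^esub> x \<otimes>\<^bsub>G\<^esub> y))"

text \<open>The limit does not depend on the base point \<open>x \<in> G\<close>; we take the identity.\<close>

definition translation_length :: "('g, 'm) monoid_scheme \<Rightarrow> 'g set \<Rightarrow> 'g \<Rightarrow> real" where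
  "translation_length G S g =
     lim (\<lambda>n::nat. word_metric G S \<one>\<^bsub>G\<^esub> (g [^]\<^bsub>G\<^esub> n) / real n)"

definition uniformly_undistorted :: "('g, 'm) monoid_scheme \<Rightarrow> 'g set \<Rightarrow> bool" where
  "uniformly_undistorted G S \<longleftrightarrow>
     (\<exists>\<tau>\<^sub>0>0. \<forall>g. infinite_order G g \<longrightarrow> \<tau>\<^sub>0 \<le> translation_length G S g)"


section \<open>Quasi-axes\<close>

definition quasi_axis ::
  "('g, 'm) monoid_scheme \<Rightarrow> 'a set \<Rightarrow> ('a \<Rightarrow> 'a \<Rightarrow> real) \<Rightarrow> ('g \<Rightarrow> 'a \<Rightarrow> 'a) \<Rightarrow>
     real \<Rightarrow> 'g \<Rightarrow> 'a set \<Rightarrow> bool" where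
  "quasi_axis G X d \<phi> q g A \<longleftrightarrow>
     0 \<le> q \<and> A \<subseteq> X \<and>
     (\<forall>h\<in>generate G {g}. \<phi> h ` A = A) \<and>
     (\<exists>f :: real \<Rightarrow> 'a.
        range f \<subseteq> A \<and>
        (\<forall>s t. \<bar>s - t\<bar> / (1 + q) - q \<le> d (f s) (f t) \<and>
               d (f s) (f t) \<le> (1 + q) * \<bar>s - t\<bar> + q) \<and>
        (\<forall>a\<in>A. \<exists>t. d a (f t) \<le> q))"

end

theory Submission
  imports Defs
begin

text \<open>
  The heart of the matter is a fact about one isometry \<open>T\<close> of an injective space: its infimal
  displacement is not larger than \<open>d p (T\<^sup>n p) / n\<close>, for every point \<open>p\<close> and every \<open>n > 0\<close>
  (\<open>displacement_le_average\<close>).  In a space with barycentres one would take the barycentre of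
  \<open>p, T p, \<dots>, T\<^sup>n\<^sup>-\<^sup>1 p\<close>: applying \<open>T\<close> exchanges only one of these \<open>n\<close> points, \<open>p\<close> against
  \<open>T\<^sup>n p\<close>.  In an injective space the barycentre is first formed among functions.  A point \<open>z\<close> is
  encoded by its distance function \<open>d z\<close>, and the mean \<open>r\<close> of the distance functions of
  \<open>p, \<dots>, T\<^sup>n\<^sup>-\<^sup>1 p\<close> still satisfies \<open>d x y \<le> r x + r y\<close>, while \<open>r \<circ> T\<close> differs from \<open>r\<close> by at most
  \<open>d p (T\<^sup>n p) / n\<close>.  Replacing \<open>r\<close> repeatedly by the mean of \<open>r\<close> and its polar
  \<open>x \<mapsto> sup\<^sub>w (d x w - r w)\<close> commutes with isometries, does not increase the difference between
  \<open>r \<circ> T\<close> and \<open>r\<close>, and brings \<open>r\<close> as close as desired to a function that is equal to its polar.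
  By injectivity there is a point \<open>z\<close> with \<open>d z \<le> r\<close>; since \<open>r\<close> almost equals its polar, \<open>r z\<close> is almost
  zero, and \<open>d z (T z) \<le> r (T z)\<close> is then at most \<open>d p (T\<^sup>n p) / n\<close> up to a small error.

  Let \<open>\<tau>\<close> be the infimal displacement of an element \<open>g\<close> of infinite order.  Uniform properness bounds
  \<open>\<tau>\<close> from below by a positive constant that is the same for all such \<open>g\<close>, because a point that is
  moved very little by \<open>g\<close> is moved little by many powers of \<open>g\<close>
  (\<open>uniform_displacement_bound\<close>).  Hence \<open>d x (g\<^sup>n x) \<ge> n \<tau>\<close> grows at a uniform linear rate.  Orbit maps are
  Lipschitz for the word metric, so the word lengths of the powers \<open>g\<^sup>n\<close> grow at a uniform linear rate too.

  For a quasi-axis, choose \<open>y\<close> with \<open>L = d y (g y)\<close> very close to \<open>\<tau>\<close>, join \<open>y\<close> to \<open>g y\<close> by a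
  1-Lipschitz path parametrised by \<open>[0, L]\<close>, and translate this path by the powers of \<open>g\<close>.  The resulting map from
  the real line is 1-Lipschitz, and over a parameter interval of length \<open>n L\<close> it moves by at least
  \<open>n \<tau>\<close>, which is almost \<open>n L\<close>; so it is almost isometric.
\<close>

section \<open>Radius functions and polarity\<close>

context Metric_space
begin

text \<open>
  The values of \<open>r\<close> are radii of balls that pairwise satisfy the obvious necessary condition for having
  a common point.  The functions that satisfy the first clause and are minimal for it form the tight
  span of the space; the second clause, which holds for all of them, is the form in which
  \<open>injective_metric_space_point\<close> applies.
\<close>

definition radius_function :: "('a \<Rightarrow> real) \<Rightarrow> bool" where
  "radius_function r \<longleftrightarrow>
     (\<forall>x\<in>M. \<forall>y\<in>M. d x y \<le> r x + r y) \<and> (\<forall>x\<in>M. \<forall>y\<in>M. r x \<le> d x y + r y)"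

text \<open>
  The least function whose sum with \<open>r\<close> dominates \<open>d\<close>.  A radius function is minimal exactly if it is
  equal to its polar.
\<close>

definition polar :: "('a \<Rightarrow> real) \<Rightarrow> 'a \<Rightarrow> real" where
  "polar r x = (SUP w\<in>M. d x w - r w)"

lemma polar_least:
  assumes "M \<noteq> {}" and "\<And>w. w \<in> M \<Longrightarrow> d x w - r w \<le> t"
  shows "polar r x \<le> t"
  unfolding polar_def using assms by (rule cSUP_least)

lemma polar_upper:
  assumes "radius_function r" "x \<in> M" "w \<in> M"
  shows "d x w - r w \<le> polar r x"
proof -
  have "bdd_above ((\<lambda>w. d x w - r w) ` M)"
    using assms by (intro bdd_aboveI2[where M = "r x"]) (auto simp: radius_function_def algebra_simps)
  thus ?thesis unfolding polar_def using assms(3) by (rule cSUP_upper2) simp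
qed

lemma polar_le:
  assumes "radius_function r" "x \<in> M"
  shows "polar r x \<le> r x"
  using assms by (intro polar_least) (auto simp: radius_function_def algebra_simps)

lemma polar_Lipschitz:
  assumes "radius_function r" "x \<in> M" "y \<in> M"
  shows "polar r x \<le> d x y + polar r y"
proof (rule polar_least)
  show "M \<noteq> {}" using assms by blast
  fix w assume "w \<in> M"
  thus "d x w - r w \<le> d x y + polar r y"
    using polar_upper[OF assms(1,3), of w] triangle[OF assms(2,3), of w] by linarith
qed

text \<open>
  Since \<open>T\<close> is an isometry of \<open>M\<close> onto itself, \<open>polar r \<circ> T\<close> is the polar of \<open>r \<circ> T\<close>, and taking polars does
  not increase the uniform distance of two functions.
\<close>

lemma polar_almost_invariant:
  assumes r: "radius_function r"
    and T: "T ` M = M" and iso: "\<And>x y. x \<in> M \<Longrightarrow> y \<in> M \<Longrightarrow> d (T x) (T y) = d x y"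
    and inv: "\<And>x. x \<in> M \<Longrightarrow> \<bar>r (T x) - r x\<bar> \<le> \<delta>"
    and x: "x \<in> M"
  shows "\<bar>polar r (T x) - polar r x\<bar> \<le> \<delta>"
proof -
  have TM: "T w \<in> M" if "w \<in> M" for w using T that by blast
  have "polar r (T x) \<le> polar r x + \<delta>"
  proof (rule polar_least)
    fix w' assume "w' \<in> M"
    then obtain w where w: "w \<in> M" "w' = T w" using T by blast
    show "d (T x) w' - r w' \<le> polar r x + \<delta>"
      using polar_upper[OF r x w(1)] inv[OF w(1)] iso[OF x w(1)] unfolding w(2) by linarith
  qed (use x in blast)
  moreover have "polar r x \<le> polar r (T x) + \<delta>"
  proof (rule polar_least)
    fix w assume w: "w \<in> M"
    show "d x w - r w \<le> polar r (T x) + \<delta>"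
      using polar_upper[OF r TM[OF x] TM[OF w]] inv[OF w] iso[OF x w] by linarith
  qed (use x in blast)
  ultimately show ?thesis by linarith
qed

text \<open>
  Replacing \<open>s\<close> by \<open>m = (s + polar s) / 2\<close> halves the gap to the polar: from \<open>m \<le> s\<close> follows
  \<open>polar s \<le> polar m\<close>, so that \<open>m - polar m \<le> m - polar s = (s - polar s) / 2\<close>.
\<close>

lemma almost_extremal_radius_function:
  assumes r: "radius_function r"
    and gap: "\<And>x. x \<in> M \<Longrightarrow> r x \<le> polar r x + C"
    and T: "T ` M = M" and iso: "\<And>x y. x \<in> M \<Longrightarrow> y \<in> M \<Longrightarrow> d (T x) (T y) = d x y"
    and inv: "\<And>x. x \<in> M \<Longrightarrow> \<bar>r (T x) - r x\<bar> \<le> \<delta>"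
  shows "\<exists>s. radius_function s \<and> (\<forall>x\<in>M. s x \<le> polar s x + C / 2 ^ k) \<and>
             (\<forall>x\<in>M. \<bar>s (T x) - s x\<bar> \<le> \<delta>)"
proof (induction k)
  case 0
  thus ?case using r gap inv by auto
next
  case (Suc k)
  then obtain s where s: "radius_function s"
    and sgap: "\<And>x. x \<in> M \<Longrightarrow> s x \<le> polar s x + C / 2 ^ k"
    and sinv: "\<And>x. x \<in> M \<Longrightarrow> \<bar>s (T x) - s x\<bar> \<le> \<delta>" by blast
  define m where "m x = (s x + polar s x) / 2" for x
  have m_le: "m x \<le> s x" if "x \<in> M" for x
    using polar_le[OF s that] by (simp add: m_def)
  have "d x y \<le> m x + m y" "m x \<le> d x y + m y" if "x \<in> M" "y \<in> M" for x y
    using polar_upper[OF s that] polar_upper[OF s that(2,1)] polar_Lipschitz[OF s that]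
      s that commute[of x y]
    by (auto simp: m_def radius_function_def field_simps) (smt (verit))
  hence "radius_function m" unfolding radius_function_def by blast
  moreover have "m x \<le> polar m x + C / 2 ^ Suc k" if x: "x \<in> M" for x
  proof -
    have "polar s x \<le> polar m x"
    proof (rule polar_least)
      fix w assume w: "w \<in> M"
      show "d x w - s w \<le> polar m x"
        using polar_upper[OF \<open>radius_function m\<close> x w] m_le[OF w] by linarith
    qed (use x in blast)
    moreover have "m x \<le> polar s x + C / 2 ^ Suc k"
      using sgap[OF x] by (simp add: m_def field_simps)
    ultimately show ?thesis by linarith
  qed
  moreover have "\<bar>m (T x) - m x\<bar> \<le> \<delta>" if x: "x \<in> M" for x
  proof -
    have "\<bar>polar s (T x) - polar s x\<bar> \<le> \<delta>"
      using s T iso sinv x by (rule polar_almost_invariant)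
    thus ?thesis using sinv[OF x] by (auto simp: m_def abs_le_iff field_simps)
  qed
  ultimately show ?case by blast
qed

end

section \<open>Isometries of injective spaces\<close>

text \<open>
  Injectivity realises a function \<open>s\<close> that is almost its own polar by a point: if \<open>d z \<le> s\<close> then
  \<open>polar s z \<le> sup\<^sub>w (d z w - d z w) = 0\<close>, hence \<open>s z\<close> is almost zero.
\<close>

lemma almost_invariant_radius_function_point:
  assumes inj: "injective_metric_space X d"
    and T: "T ` X = X" and iso: "\<And>x y. x \<in> X \<Longrightarrow> y \<in> X \<Longrightarrow> d (T x) (T y) = d x y"
    and r: "Metric_space.radius_function X d r"
    and inv: "\<And>x. x \<in> X \<Longrightarrow> \<bar>r (T x) - r x\<bar> \<le> \<delta>"
    and \<epsilon>: "0 < \<epsilon>"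
  shows "\<exists>z\<in>X. d z (T z) \<le> \<delta> + \<epsilon>"
proof -
  interpret Metric_space X d
    using inj by (simp add: injective_metric_space_def injective_for_def)
  obtain p where p: "p \<in> X" using injective_metric_space_nonempty[OF inj] by blast
  \<comment> \<open>A uniform bound for the gap: \<open>polar r x \<ge> d x p - r p \<ge> r x - 2 * r p\<close>.\<close>
  define C where "C = 2 * r p"
  have "r x \<le> polar r x + C" if x: "x \<in> X" for x
    using polar_upper[OF r x p] r x p unfolding radius_function_def C_def by force
  moreover obtain k where "C / \<epsilon> < 2 ^ k"
    using real_arch_pow[of 2 "C / \<epsilon>"] by auto
  hence k: "C / 2 ^ k < \<epsilon>" using \<epsilon> by (simp add: field_simps)
  ultimately obtain s where s: "radius_function s"
    and gap: "\<And>x. x \<in> X \<Longrightarrow> s x \<le> polar s x + C / 2 ^ k"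
    and sinv: "\<And>x. x \<in> X \<Longrightarrow> \<bar>s (T x) - s x\<bar> \<le> \<delta>"
    using almost_extremal_radius_function[OF r _ T iso inv] by blast
  have "0 \<le> s x" if "x \<in> X" for x
    using s that unfolding radius_function_def by fastforce
  then obtain z where z: "z \<in> X" "\<And>x. x \<in> X \<Longrightarrow> d z x \<le> s x"
    using injective_metric_space_point[OF inj, of s] s unfolding radius_function_def by blast
  have "polar s z \<le> 0"
    using z p by (intro polar_least) auto
  hence "s z \<le> \<epsilon>" using gap[OF z(1)] k by linarith
  moreover have "d z (T z) \<le> s (T z)" using z T by blast
  ultimately have "d z (T z) \<le> \<delta> + \<epsilon>" using sinv[OF z(1)] by linarith
  thus ?thesis using z(1) by blast
qed

text \<open>
  The mean of the distance functions of \<open>p, T p, \<dots>, T\<^sup>n\<^sup>-\<^sup>1 p\<close> plays the role of the barycentre of these points.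
  Its variation along \<open>T\<close> telescopes to \<open>(d p (T x) - d (T\<^sup>n p) (T x)) / n\<close>.
\<close>

theorem displacement_le_average:
  assumes inj: "injective_metric_space X d"
    and T: "T ` X = X" and iso: "\<And>x y. x \<in> X \<Longrightarrow> y \<in> X \<Longrightarrow> d (T x) (T y) = d x y"
    and p: "p \<in> X" and n: "0 < n" and \<epsilon>: "0 < \<epsilon>"
  shows "\<exists>z\<in>X. d z (T z) \<le> d p ((T ^^ n) p) / n + \<epsilon>"
proof -
  interpret Metric_space X d
    using inj by (simp add: injective_metric_space_def injective_for_def)
  have orb: "(T ^^ i) p \<in> X" for i
    by (induction i) (use p T in auto)
  define r where "r x = (\<Sum>i<n. d ((T ^^ i) p) x) / n" for x
  have "d x y \<le> r x + r y" "r x \<le> d x y + r y" if xy: "x \<in> X" "y \<in> X" for x y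
  proof -
    have "(\<Sum>i<n. d x y) \<le> (\<Sum>i<n. d ((T ^^ i) p) x + d ((T ^^ i) p) y)"
      by (rule sum_mono) (rule triangle''[OF xy(1) orb xy(2)])
    thus "d x y \<le> r x + r y"
      using n by (simp add: r_def sum.distrib field_simps)
    have "(\<Sum>i<n. d ((T ^^ i) p) x) \<le> (\<Sum>i<n. d x y + d ((T ^^ i) p) y)"
      by (rule sum_mono) (metis triangle'[OF orb xy(2,1)] add.commute)
    thus "r x \<le> d x y + r y"
      using n by (simp add: r_def sum.distrib field_simps)
  qed
  hence "radius_function r" unfolding radius_function_def by blast
  moreover have "\<bar>r (T x) - r x\<bar> \<le> d p ((T ^^ n) p) / n" if x: "x \<in> X" for x
  proof -
    have Tx: "T x \<in> X" using T x by blast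
    have "(\<Sum>i<n. d ((T ^^ i) p) x) = (\<Sum>i<n. d ((T ^^ Suc i) p) (T x))"
      using iso[OF orb x] by simp
    hence "r (T x) - r x = (\<Sum>i<n. d ((T ^^ i) p) (T x) - d ((T ^^ Suc i) p) (T x)) / n"
      by (simp only: r_def sum_subtractf diff_divide_distrib)
    also have "\<dots> = (d p (T x) - d ((T ^^ n) p) (T x)) / n"
      by (subst sum_lessThan_telescope') simp
    finally have "\<bar>r (T x) - r x\<bar> = \<bar>d p (T x) - d ((T ^^ n) p) (T x)\<bar> / n" by simp
    moreover have "\<bar>d p (T x) - d ((T ^^ n) p) (T x)\<bar> \<le> d p ((T ^^ n) p)"
      using mdist_reverse_triangle[OF p Tx orb[of n]] commute by simp
    ultimately show ?thesis using n by (simp add: divide_right_mono)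
  qed
  ultimately show ?thesis
    using almost_invariant_radius_function_point[OF inj T iso _ _ \<epsilon>] by blast
qed

text \<open>
  The map that sends the endpoints of the interval \<open>[0, d x y]\<close> to \<open>x\<close> and \<open>y\<close> is 1-Lipschitz, so it extends
  to the whole interval.
\<close>

lemma injective_metric_space_segment:
  assumes inj: "injective_metric_space X d" and xy: "x \<in> X" "y \<in> X"
  obtains c where "c 0 = x" "c (d x y) = y"
    "\<And>s. s \<in> {0..d x y} \<Longrightarrow> c s \<in> X"
    "\<And>s t. s \<in> {0..d x y} \<Longrightarrow> t \<in> {0..d x y} \<Longrightarrow> d (c s) (c t) \<le> \<bar>s - t\<bar>"
proof -
  interpret Metric_space X d
    using inj by (simp add: injective_metric_space_def injective_for_def)
  let ?f = "\<lambda>s::real. if s = 0 then x else y"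
  have "Metric_space {0..d x y} (\<lambda>s t::real. \<bar>s - t\<bar>)"
    by unfold_locales auto
  moreover have "{0, d x y} \<subseteq> {0..d x y}" by simp
  moreover have "one_lipschitz_map {0, d x y} (\<lambda>s t::real. \<bar>s - t\<bar>) X d ?f"
    using xy commute[of y x] by (auto simp: one_lipschitz_map_def)
  ultimately obtain c where c: "one_lipschitz_map {0..d x y} (\<lambda>s t::real. \<bar>s - t\<bar>) X d c"
      "\<forall>s\<in>{0, d x y}. c s = ?f s"
    using injective_metric_space_extension[OF inj, where 'b = real]
    unfolding injective_for_def by blast
  show thesis
  proof
    show "c 0 = x" "c (d x y) = y" using c(2) xy by auto
  qed (use c(1) in \<open>auto simp: one_lipschitz_map_def\<close>)
qed

section \<open>Isometric group actions\<close>

locale isometric_group_action = Metric_space X d + group_action G X \<phi>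
  for G :: "('g, 'm) monoid_scheme" (structure) and X :: "'a set" and d \<phi> +
  assumes isometry: "g \<in> carrier G \<Longrightarrow> x \<in> X \<Longrightarrow> y \<in> X \<Longrightarrow> d (\<phi> g x) (\<phi> g y) = d x y"
begin

sublocale group G
  using group_hom by (rule group_hom.axioms(1))

lemma action_closed: "g \<in> carrier G \<Longrightarrow> x \<in> X \<Longrightarrow> \<phi> g x \<in> X"
  using surj_prop by blast

lemma action_one: "x \<in> X \<Longrightarrow> \<phi> \<one> x = x"
  by (metis id_eq_one restrict_apply')

lemma action_mult: "x \<in> X \<Longrightarrow> g \<in> carrier G \<Longrightarrow> h \<in> carrier G \<Longrightarrow> \<phi> (g \<otimes> h) x = \<phi> g (\<phi> h x)"
  by (rule composition_rule)

lemma action_pow: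
  assumes "g \<in> carrier G" "x \<in> X"
  shows "\<phi> (g [^] (n::nat)) x = (\<phi> g ^^ n) x"
proof (induction n)
  case (Suc n)
  have "\<phi> (g [^] Suc n) x = \<phi> (g \<otimes> g [^] n) x"
    using assms nat_pow_Suc2 by simp
  thus ?case using Suc assms by (simp add: action_mult)
qed (simp add: action_one assms)

lemma displacement_mult:
  assumes "g \<in> carrier G" "h \<in> carrier G" "x \<in> X"
  shows "d x (\<phi> (g \<otimes> h) x) \<le> d x (\<phi> g x) + d x (\<phi> h x)"
  using triangle[of x "\<phi> g x" "\<phi> g (\<phi> h x)"] assms
  by (simp add: action_mult action_closed isometry)

lemma displacement_inv:
  assumes "g \<in> carrier G" "x \<in> X"
  shows "d x (\<phi> (inv g) x) = d x (\<phi> g x)"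
  using isometry[of g x "\<phi> (inv g) x"] assms
  by (simp add: action_closed action_one commute flip: action_mult)

lemma displacement_pow:
  assumes "g \<in> carrier G" "x \<in> X"
  shows "d x (\<phi> (g [^] (n::nat)) x) \<le> real n * d x (\<phi> g x)"
proof (induction n)
  case (Suc n)
  thus ?case
    using displacement_mult[of "g [^] n" g x] assms by (simp add: algebra_simps)
qed (simp add: action_one assms)

text \<open>
  If \<open>g\<close> moves \<open>x\<close> by less than \<open>1 / (N + 1)\<close>, then each of the \<open>N + 1\<close> powers \<open>g\<^sup>0, \<dots>, g\<^sup>N\<close> moves
  \<open>x\<close> by at most \<open>1\<close>.  These powers are distinct if \<open>g\<close> has infinite order, which is impossible for
  the \<open>N\<close> that properness gives for distance \<open>1\<close>.
\<close>

lemma uniform_displacement_bound: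
  assumes "uniformly_proper G X d \<phi>"
  obtains \<delta> where "0 < \<delta>" "\<And>g x. infinite_order G g \<Longrightarrow> x \<in> X \<Longrightarrow> \<delta> \<le> d x (\<phi> g x)"
proof -
  obtain N :: nat where N: "\<And>x. x \<in> X \<Longrightarrow> finite {g \<in> carrier G. d x (\<phi> g x) \<le> 1}"
    "\<And>x. x \<in> X \<Longrightarrow> card {g \<in> carrier G. d x (\<phi> g x) \<le> 1} \<le> N"
    using assms unfolding uniformly_proper_def by (meson zero_less_one)
  show thesis
  proof
    show "0 < 1 / (real N + 1)" by simp
    fix g x assume g: "infinite_order G g" and x: "x \<in> X"
    have gG: "g \<in> carrier G" and ord: "ord g = 0" using g by (auto simp: infinite_order_def)
    show "1 / (real N + 1) \<le> d x (\<phi> g x)"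
    proof (rule ccontr)
      assume "\<not> ?thesis"
      hence small: "(real N + 1) * d x (\<phi> g x) \<le> 1" by (simp add: field_simps)
      have "d x (\<phi> (g [^] i) x) \<le> 1" if "i \<le> N" for i :: nat
      proof -
        have "real i * d x (\<phi> g x) \<le> (real N + 1) * d x (\<phi> g x)"
          using that by (intro mult_right_mono) auto
        thus ?thesis using displacement_pow[OF gG x, of i] small by linarith
      qed
      hence "(\<lambda>i::nat. g [^] i) ` {..N} \<subseteq> {g \<in> carrier G. d x (\<phi> g x) \<le> 1}"
        using gG by auto
      moreover have "inj_on (\<lambda>i::nat. g [^] i) {..N}"
        unfolding inj_on_def using ord_eq_0[OF gG] ord pow_eq_div2[OF gG]
        by (metis diffs0_imp_equal)
      ultimately have "card {..N} \<le> N"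
        using card_inj_on_le N[OF x] by (meson le_trans)
      thus False by simp
    qed
  qed
qed

end

section \<open>Word lengths\<close>

text \<open>
  Fekete's lemma: the means converge to their infimum \<open>L\<close>.  If \<open>a m / m\<close> is close to \<open>L\<close>, division of \<open>n\<close> by \<open>m\<close>
  with remainder bounds \<open>a n\<close> by \<open>n * (a m / m)\<close> up to a constant that depends only on \<open>m\<close>.
\<close>

lemma subadditive_mean_convergent:
  fixes a :: "nat \<Rightarrow> real"
  assumes nonneg: "\<And>n. 0 \<le> a n" and sub: "\<And>m n. a (m + n) \<le> a m + a n"
  shows "convergent (\<lambda>n. a n / n)"
proof -
  define L where "L = (INF n\<in>{1..}. a n / n)"
  have bdd: "bdd_below ((\<lambda>n. a n / n) ` {1..})"
    using nonneg by (intro bdd_belowI2[where m = 0]) simp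
  have mult: "a (k * m + j) \<le> k * a m + a j" for k m j
  proof (induction k)
    case (Suc k)
    thus ?case using sub[of m "k * m + j"] by (simp add: algebra_simps)
  qed simp
  have "(\<lambda>n. a n / n) \<longlonglongrightarrow> L"
  proof (rule LIMSEQ_I)
    fix e :: real assume e: "0 < e"
    have "\<exists>m\<in>{1..}. a m / m < L + e / 2"
      using cINF_less_iff[OF _ bdd, of "L + e / 2"] e by (simp add: L_def)
    then obtain m where m: "1 \<le> m" "a m / m < L + e / 2" by auto
    define C where "C = m * a 1 + a 0"
    have C: "0 \<le> C" using nonneg by (simp add: C_def)
    obtain n0 :: nat where n0: "2 * C / e < n0" using reals_Archimedean2 by blast
    have "norm (a n / n - L) < e" if n: "Suc n0 \<le> n" for n
    proof -
      have npos: "0 < n" using n by simp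
      have "a (n mod m) \<le> C"
      proof -
        have "a (n mod m) \<le> (n mod m) * a 1 + a 0" using mult[of "n mod m" 1 0] by simp
        moreover have "(n mod m) * a 1 \<le> m * a 1"
          using m nonneg by (intro mult_right_mono) (auto intro: less_imp_le)
        ultimately show ?thesis by (simp add: C_def)
      qed
      hence "a n \<le> (n div m) * a m + C"
        using mult[of "n div m" m "n mod m"] by simp
      also have "(n div m) * a m = (n div m * m) * (a m / m)" using m by simp
      also have "\<dots> \<le> n * (a m / m)"
        using nonneg m by (intro mult_right_mono) (auto simp flip: of_nat_mult)
      finally have "a n / n \<le> a m / m + C / n" using npos by (simp add: field_simps)
      moreover have "C / n < e / 2"
      proof -
        have "2 * C / e < n" using n0 n by linarith
        thus ?thesis using e npos by (simp add: field_simps)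
      qed
      moreover have "L \<le> a n / n"
        unfolding L_def using npos by (intro cINF_lower[OF bdd]) simp
      ultimately have "a n / n - L < e" "L \<le> a n / n" using m(2) by linarith+
      thus ?thesis by simp
    qed
    thus "\<exists>no. \<forall>n\<ge>no. norm (a n / n - L) < e" by blast
  qed
  thus ?thesis by (rule convergentI)
qed

context group
begin

abbreviation word_product :: "'a list \<Rightarrow> 'a" where
  "word_product ws \<equiv> foldr (\<lambda>a b. a \<otimes> b) ws \<one>"

lemma word_product_closed: "set ws \<subseteq> carrier G \<Longrightarrow> word_product ws \<in> carrier G"
  by (induction ws) auto

lemma word_product_append:
  assumes "set us \<subseteq> carrier G" "set vs \<subseteq> carrier G"
  shows "word_product (us @ vs) = word_product us \<otimes> word_product vs"
  using assms by (induction us) (auto simp: m_assoc word_product_closed)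

lemma word_exists:
  assumes S: "S \<subseteq> carrier G" and h: "h \<in> generate G S"
  shows "\<exists>ws. set ws \<subseteq> S \<union> (\<lambda>s. inv s) ` S \<and> word_product ws = h"
  using h
proof induction
  case one
  thus ?case by (intro exI[of _ "[]"]) simp
next
  case (incl h)
  thus ?case using S by (intro exI[of _ "[h]"]) auto
next
  case (inv h)
  thus ?case using S by (intro exI[of _ "[inv h]"]) auto
next
  case (eng h1 h2)
  then obtain us vs where uv: "set us \<subseteq> S \<union> (\<lambda>s. inv s) ` S" "word_product us = h1"
      "set vs \<subseteq> S \<union> (\<lambda>s. inv s) ` S" "word_product vs = h2" by blast
  moreover have "S \<union> (\<lambda>s. inv s) ` S \<subseteq> carrier G" using S by auto
  ultimately have "word_product (us @ vs) = h1 \<otimes> h2"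
    by (metis order_trans word_product_append)
  thus ?case using uv by (intro exI[of _ "us @ vs"]) simp
qed

lemma word_length_word:
  assumes "finite_generating_set G S" "h \<in> carrier G"
  obtains ws where "length ws = word_length G S h" "set ws \<subseteq> S \<union> (\<lambda>s. inv s) ` S"
    "word_product ws = h"
proof -
  have "\<exists>n ws. length ws = n \<and> set ws \<subseteq> S \<union> (\<lambda>s. inv s) ` S \<and> word_product ws = h"
    using word_exists[of S h] assms unfolding finite_generating_set_def by blast
  from LeastI_ex[OF this] show thesis
    using that unfolding word_length_def by blast
qed

lemma word_length_le:
  assumes "set ws \<subseteq> S \<union> (\<lambda>s. inv s) ` S" "word_product ws = h"
  shows "word_length G S h \<le> length ws"
  unfolding word_length_def using assms by (intro Least_le) blast

lemma word_length_mult: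
  assumes S: "finite_generating_set G S" and gh: "g \<in> carrier G" "h \<in> carrier G"
  shows "word_length G S (g \<otimes> h) \<le> word_length G S g + word_length G S h"
proof -
  obtain us where us: "length us = word_length G S g" "set us \<subseteq> S \<union> (\<lambda>s. inv s) ` S"
    "word_product us = g" using word_length_word[OF S gh(1)] by blast
  obtain vs where vs: "length vs = word_length G S h" "set vs \<subseteq> S \<union> (\<lambda>s. inv s) ` S"
    "word_product vs = h" using word_length_word[OF S gh(2)] by blast
  have "S \<union> (\<lambda>s. inv s) ` S \<subseteq> carrier G" using S by (auto simp: finite_generating_set_def)
  hence "word_product (us @ vs) = g \<otimes> h"
    using us vs by (metis order_trans word_product_append)
  thus ?thesis using word_length_le[of "us @ vs" S "g \<otimes> h"] us vs by simp
qed

text \<open>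
  The translation length is defined through \<open>lim\<close>, which is meaningful only because the sequence converges;
  subadditivity of the word length provides this.
\<close>

lemma translation_length_ge:
  fixes t :: real
  assumes S: "finite_generating_set G S" and g: "g \<in> carrier G"
    and low: "\<And>n::nat. 0 < n \<Longrightarrow> t * real n \<le> real (word_length G S (g [^] n))"
  shows "t \<le> translation_length G S g"
proof -
  have word: "word_metric G S \<one> (g [^] n) = real (word_length G S (g [^] n))" for n :: nat
    using g by (simp add: word_metric_def)
  have "convergent (\<lambda>n::nat. real (word_length G S (g [^] n)) / real n)"
  proof (rule subadditive_mean_convergent)
    fix m n :: nat
    show "real (word_length G S (g [^] (m + n)))
        \<le> real (word_length G S (g [^] m)) + real (word_length G S (g [^] n))"
      using word_length_mult[OF S, of "g [^] m" "g [^] n"] g by (simp add: nat_pow_mult)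
  qed simp
  hence "(\<lambda>n::nat. real (word_length G S (g [^] n)) / real n) \<longlonglongrightarrow> translation_length G S g"
    unfolding translation_length_def word by (rule convergent_LIMSEQ_iff[THEN iffD1])
  moreover have "\<forall>n\<ge>1. t \<le> real (word_length G S (g [^] n)) / real n"
    using low by (auto simp: field_simps)
  ultimately show ?thesis by (blast intro: LIMSEQ_le_const)
qed

end

context isometric_group_action
begin

text \<open>
  Orbit maps are Lipschitz: one letter moves \<open>x\<close> by at most \<open>K\<close>, and displacements at \<open>x\<close> are
  subadditive under multiplication.
\<close>

lemma displacement_le_word_length:
  assumes S: "finite_generating_set G S" and x: "x \<in> X"
  obtains K :: real where "0 < K" "\<And>h. h \<in> carrier G \<Longrightarrow> d x (\<phi> h x) \<le> K * word_length G S h"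
proof -
  have fin: "finite S" and SG: "S \<subseteq> carrier G" using S by (auto simp: finite_generating_set_def)
  \<comment> \<open>The summand 1 makes \<open>K\<close> positive when \<open>x\<close> is fixed by all generators.\<close>
  define K where "K = 1 + (\<Sum>s\<in>S. d x (\<phi> s x))"
  have K: "d x (\<phi> a x) \<le> K" if a: "a \<in> S \<union> (\<lambda>s. inv s) ` S" for a
  proof -
    obtain s where s: "s \<in> S" "d x (\<phi> a x) = d x (\<phi> s x)"
      using a SG x displacement_inv by auto
    show ?thesis
      using member_le_sum[of s S "\<lambda>s. d x (\<phi> s x)"] s fin by (simp add: K_def)
  qed
  have *: "d x (\<phi> (word_product ws) x) \<le> K * length ws"
    if "set ws \<subseteq> S \<union> (\<lambda>s. inv s) ` S" for ws
    using that
  proof (induction ws)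
    case Nil
    thus ?case using x by (simp add: action_one)
  next
    case (Cons a ws)
    have "a \<in> carrier G" "set ws \<subseteq> carrier G" using Cons.prems SG by auto
    hence "d x (\<phi> (word_product (a # ws)) x) \<le> d x (\<phi> a x) + d x (\<phi> (word_product ws) x)"
      using displacement_mult x word_product_closed by simp
    also have "\<dots> \<le> K + K * length ws" using Cons K by (intro add_mono) auto
    finally show ?case by (simp add: algebra_simps)
  qed
  show thesis
  proof
    show "0 < K" unfolding K_def by (smt (verit) nonneg sum_nonneg)
    show "d x (\<phi> h x) \<le> K * word_length G S h" if "h \<in> carrier G" for h
      using word_length_word[OF S that] * by metis
  qed
qed

section \<open>Quasi-axes\<close>

text \<open>
  The translates of a 1-Lipschitz path from \<open>y\<close> to \<open>g y\<close> by the powers of \<open>g\<close> fit together to a path on the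
  real line.  It is 1-Lipschitz on each piece; two parameters in different pieces are compared by passing through
  the orbit points \<open>g\<^sup>k y\<close> between them.
\<close>

lemma periodic_path:
  assumes inj: "injective_metric_space X d" and g: "g \<in> carrier G"
    and y: "y \<in> X" and L: "0 < d y (\<phi> g y)"
  obtains f :: "real \<Rightarrow> 'a" where "range f \<subseteq> X" "\<And>s t. d (f s) (f t) \<le> \<bar>s - t\<bar>"
    "\<And>(k::int) t. \<phi> (g [^] k) (f t) = f (t + real_of_int k * d y (\<phi> g y))"
proof -
  define L where "L = d y (\<phi> g y)"
  have L0: "0 < L" using L by (simp add: L_def)
  have gk: "g [^] k \<in> carrier G" for k :: int using g by simp
  obtain c where c: "c 0 = y" "c L = \<phi> g y"
    and cX: "\<And>s. s \<in> {0..L} \<Longrightarrow> c s \<in> X"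
    and cL: "\<And>s t. s \<in> {0..L} \<Longrightarrow> t \<in> {0..L} \<Longrightarrow> d (c s) (c t) \<le> \<bar>s - t\<bar>"
    using injective_metric_space_segment[OF inj y action_closed[OF g y]] unfolding L_def by blast
  define m where "m t = \<lfloor>t / L\<rfloor>" for t
  have m: "t - m t * L \<in> {0..L}" for t
  proof -
    have "m t \<le> t / L" "t / L \<le> m t + 1" unfolding m_def by linarith+
    thus ?thesis using L0 by (simp add: field_simps)
  qed
  define f where "f t = \<phi> (g [^] m t) (c (t - m t * L))" for t
  have fX: "f t \<in> X" for t unfolding f_def by (intro action_closed gk cX m)
  have shift: "\<phi> (g [^] k) (f t) = f (t + real_of_int k * L)" for k :: int and t
  proof -
    have "m (t + k * L) = k + m t" using L0 by (simp add: m_def add_divide_distrib)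
    thus ?thesis
      using cX[OF m, of t] g by (simp add: f_def algebra_simps int_pow_mult flip: action_mult)
  qed
  \<comment> \<open>The endpoints of the pieces: \<open>v k\<close> is the value of \<open>f\<close> at \<open>k * L\<close>.\<close>
  define v where "v k = \<phi> (g [^] k) y" for k :: int
  have vX: "v k \<in> X" for k unfolding v_def by (intro action_closed gk y)
  have v_Suc: "v (k + 1) = \<phi> (g [^] k) (c L)" for k
    using g y by (simp add: v_def c action_mult int_pow_mult)
  have start: "d (v (m t)) (f t) \<le> t - m t * L" for t
  proof -
    have "d (v (m t)) (f t) = d (c 0) (c (t - m t * L))"
      using isometry[OF gk cX cX[OF m], of 0] L0 by (simp add: v_def f_def flip: c(1))
    also have "\<dots> \<le> \<bar>0 - (t - m t * L)\<bar>" using L0 by (intro cL m) simp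
    finally show ?thesis using m[of t] by simp
  qed
  have stop: "d (f t) (v (m t + 1)) \<le> (m t + 1) * L - t" for t
  proof -
    have "d (f t) (v (m t + 1)) = d (c (t - m t * L)) (c L)"
      using isometry[OF gk cX[OF m] cX, of L] L0 by (simp add: v_Suc f_def)
    also have "\<dots> \<le> \<bar>(t - m t * L) - L\<bar>" using L0 by (intro cL m) simp
    finally show ?thesis using m[of t] by (simp add: algebra_simps)
  qed
  have step: "d (v k) (v (k + 1)) = L" for k
    using isometry[OF gk y action_closed[OF g y], of k] unfolding v_Suc c(2) by (simp add: v_def L_def)
  have steps: "d (v k) (v (k + int n)) \<le> n * L" for k n
  proof (induction n)
    case (Suc n)
    thus ?case
      using triangle[OF vX[of k] vX[of "k + int n"] vX[of "k + int n + 1"]] step[of "k + int n"]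
      by (simp add: algebra_simps)
  qed (simp add: vX)
  have le: "d (f s) (f t) \<le> t - s" if st: "s \<le> t" for s t
  proof -
    have mono: "m s \<le> m t" using st L0 by (simp add: m_def floor_mono divide_right_mono)
    show ?thesis
    proof (cases "m s = m t")
      case True
      thus ?thesis
        using isometry[OF gk cX[OF m] cX[OF m], of "m t" s t] cL[OF m m, of s t] st
        by (simp add: f_def)
    next
      case False
      define n where "n = nat (m t - (m s + 1))"
      have n: "m t = m s + 1 + int n" using mono False by (simp add: n_def)
      have "d (f s) (f t) \<le> d (f s) (v (m s + 1)) + (d (v (m s + 1)) (v (m t)) + d (v (m t)) (f t))"
        using triangle[OF fX[of s] vX[of "m s + 1"] fX[of t]]
          triangle[OF vX[of "m s + 1"] vX[of "m t"] fX[of t]]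
        by linarith
      also have "\<dots> \<le> ((m s + 1) * L - s) + (n * L + (t - m t * L))"
        using stop[of s] start[of t] steps[of "m s + 1" n] unfolding n
        by (intro add_mono) (auto simp: n)
      also have "\<dots> = t - s" by (simp add: n algebra_simps)
      finally show ?thesis .
    qed
  qed
  show thesis
  proof
    show "range f \<subseteq> X" using fX by blast
    show "d (f s) (f t) \<le> \<bar>s - t\<bar>" for s t
      using le[of s t] le[of t s] commute[of "f s" "f t"] by (cases "s \<le> t") auto
    show "\<phi> (g [^] k) (f t) = f (t + real_of_int k * d y (\<phi> g y))" for k :: int and t
      using shift unfolding L_def .
  qed
qed

text \<open>
  For \<open>s \<le> t\<close>, let \<open>n\<close> be the least number of periods with \<open>s + n L \<ge> t\<close>.  Then \<open>f (s + n L) = g\<^sup>n (f s)\<close> is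
  at distance at least \<open>n \<tau>\<close> from \<open>f s\<close> and at most \<open>n L - (t - s)\<close> from \<open>f t\<close>.  Because \<open>n \<le> (t - s) / L + 1\<close>,
  the triangle inequality gives \<open>d (f s) (f t) \<ge> (t - s) * (\<tau> / L) - (L - \<tau>)\<close>.  The two upper bounds on \<open>L\<close>
  turn this into the multiplicative and the additive part of the quasi-isometry inequality.
\<close>

lemma periodic_path_quasi_axis:
  assumes g: "g \<in> carrier G" and \<epsilon>: "0 < \<epsilon>"
    and f: "range f \<subseteq> X" and Lip: "\<And>s t. d (f s) (f t) \<le> \<bar>s - t\<bar>"
    and shift: "\<And>(k::int) t. \<phi> (g [^] k) (f t) = f (t + real_of_int k * L)"
    and low: "\<And>x (n::nat). x \<in> X \<Longrightarrow> real n * \<tau> \<le> d x (\<phi> (g [^] n) x)"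
    and L: "0 < L" "\<tau> \<le> L" "L \<le> (1 + \<epsilon>) * \<tau>" "L \<le> \<tau> + \<epsilon>"
  shows "quasi_axis G X d \<phi> \<epsilon> g (range f)"
proof -
  have fX: "f t \<in> X" for t using f by blast
  have lower: "(t - s) / (1 + \<epsilon>) - \<epsilon> \<le> d (f s) (f t)" if st: "s \<le> t" for s t
  proof -
    define T where "T = t - s"
    have T: "0 \<le> T" using st by (simp add: T_def)
    define n where "n = nat \<lceil>T / L\<rceil>"
    have n: "T / L \<le> n" "n \<le> T / L + 1"
      using T L by (auto simp: n_def) 
    have nL: "T \<le> n * L" using n(1) L by (simp add: field_simps)
    have "n * \<tau> \<le> d (f s) (f (s + n * L))"
      using low[OF fX[of s], of n] shift[of "int n" s] by (simp add: int_pow_int)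
    also have "\<dots> \<le> d (f s) (f t) + d (f t) (f (s + n * L))"
      by (rule triangle) (rule fX)+
    also have "d (f t) (f (s + n * L)) \<le> n * L - T"
      using Lip[of t "s + n * L"] nL by (simp add: T_def)
    finally have "T - n * (L - \<tau>) \<le> d (f s) (f t)" by (simp add: algebra_simps)
    moreover have "n * (L - \<tau>) \<le> (T / L + 1) * (L - \<tau>)"
      using n(2) L by (intro mult_right_mono) auto
    moreover have "T - (T / L + 1) * (L - \<tau>) = T * (\<tau> / L) - (L - \<tau>)"
      using L by (simp add: field_simps)
    moreover have "T / (1 + \<epsilon>) \<le> T * (\<tau> / L)"
    proof -
      have "1 / (1 + \<epsilon>) \<le> \<tau> / L" using L \<epsilon> by (simp add: field_simps)
      from mult_left_mono[OF this T] show ?thesis by simp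
    qed
    ultimately show ?thesis using L(4) unfolding T_def by linarith
  qed
  have "\<bar>s - t\<bar> / (1 + \<epsilon>) - \<epsilon> \<le> d (f s) (f t)" for s t
    using lower[of s t] lower[of t s] commute[of "f s" "f t"] by (cases "s \<le> t") auto
  moreover have "d (f s) (f t) \<le> (1 + \<epsilon>) * \<bar>s - t\<bar> + \<epsilon>" for s t
  proof -
    have "0 \<le> \<epsilon> * \<bar>s - t\<bar>" using \<epsilon> by simp
    moreover have "(1 + \<epsilon>) * \<bar>s - t\<bar> = \<bar>s - t\<bar> + \<epsilon> * \<bar>s - t\<bar>"
      by (simp add: distrib_right)
    ultimately show ?thesis using Lip[of s t] \<epsilon> by linarith
  qed
  moreover have "\<exists>t. d a (f t) \<le> \<epsilon>" if "a \<in> range f" for a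
    using that fX \<epsilon> by (metis imageE mdist_zero less_imp_le)
  moreover have "\<phi> h ` range f = range f" if h: "h \<in> generate G {g}" for h
  proof -
    obtain k :: int where k: "h = g [^] k" using h generate_pow[OF g] by blast
    have "\<phi> h ` range f = range (\<lambda>t. f (t + k * L))"
      by (simp add: image_image k shift)
    also have "\<dots> = f ` range (\<lambda>t. t + k * L)"
      by (simp only: image_image)
    also have "range (\<lambda>t. t + k * L) = UNIV"
      by (rule surjI[where f = "\<lambda>t. t - k * L"]) simp
    finally show ?thesis .
  qed
  ultimately show ?thesis
    unfolding quasi_axis_def using f \<epsilon> by (intro conjI exI[of _ f]) auto
qed

end

theorem theorem1p2:
  fixes G :: "('g, 'm) monoid_scheme"
    and X :: "'a set" and d :: "'a \<Rightarrow> 'a \<Rightarrow> real"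
    and \<phi> :: "'g \<Rightarrow> 'a \<Rightarrow> 'a"
  assumes "group G"
    and "injective_metric_space X d"
    and "isometric_action G X d \<phi>"
    and "uniformly_proper G X d \<phi>"
  shows "(\<forall>S. finite_generating_set G S \<longrightarrow> uniformly_undistorted G S) \<and>
         (\<forall>g. infinite_order G g \<longrightarrow> (\<forall>\<epsilon>>0. \<exists>A. quasi_axis G X d \<phi> \<epsilon> g A))"
proof -
  note inj = assms(2)
  interpret isometric_group_action G X d \<phi>
    using assms(2,3)
    by (auto simp: isometric_group_action_def isometric_group_action_axioms_def
        isometric_action_def injective_metric_space_def injective_for_def)
  obtain x0 where x0: "x0 \<in> X" using injective_metric_space_nonempty[OF inj] by blast
  obtain \<delta> where \<delta>: "0 < \<delta>" "\<And>g x. infinite_order G g \<Longrightarrow> x \<in> X \<Longrightarrow> \<delta> \<le> d x (\<phi> g x)"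
    using uniform_displacement_bound[OF assms(4)] by blast
  define \<tau> where "\<tau> g = (INF x\<in>X. d x (\<phi> g x))" for g
  have \<tau>_le: "\<tau> g \<le> d x (\<phi> g x)" if "x \<in> X" for g x
    unfolding \<tau>_def using that by (intro cINF_lower bdd_belowI2[where m = 0]) auto
  have \<delta>_le: "\<delta> \<le> \<tau> g" if "infinite_order G g" for g
    unfolding \<tau>_def using x0 \<delta>(2)[OF that] by (intro cINF_greatest) auto
  have linear: "real n * \<tau> g \<le> d x (\<phi> (g [^]\<^bsub>G\<^esub> n) x)" if g: "g \<in> carrier G" and x: "x \<in> X" for g x and n :: nat
  proof (cases "n = 0")
    case False
    have "\<tau> g \<le> d x (\<phi> (g [^]\<^bsub>G\<^esub> n) x) / real n + e" if "0 < e" for e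
    proof -
      have "0 < n" using False by simp
      with inj surj_prop[OF g] isometry[OF g] x
      have "\<exists>z\<in>X. d z (\<phi> g z) \<le> d x ((\<phi> g ^^ n) x) / n + e"
        using that by (rule displacement_le_average)
      thus ?thesis using \<tau>_le action_pow[OF g x] by (metis order_trans)
    qed
    hence "\<tau> g \<le> d x (\<phi> (g [^]\<^bsub>G\<^esub> n) x) / real n" by (rule field_le_epsilon)
    thus ?thesis using False by (simp add: field_simps)
  qed simp
  have "uniformly_undistorted G S" if S: "finite_generating_set G S" for S
  proof -
    obtain K :: real where K: "0 < K" "\<And>h. h \<in> carrier G \<Longrightarrow> d x0 (\<phi> h x0) \<le> K * word_length G S h"
      using displacement_le_word_length[OF S x0] by blast
    have "\<delta> / K \<le> translation_length G S g" if g: "infinite_order G g" for g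
    proof (rule translation_length_ge[OF S])
      show gG: "g \<in> carrier G" using g by (simp add: infinite_order_def)
      fix n :: nat
      have "n * \<delta> \<le> n * \<tau> g" using \<delta>_le[OF g] by (intro mult_left_mono) auto
      also have "\<dots> \<le> K * real (word_length G S (g [^]\<^bsub>G\<^esub> n))"
        using linear[OF gG x0, of n] K(2)[of "g [^]\<^bsub>G\<^esub> n"] gG by simp
      finally show "\<delta> / K * real n \<le> real (word_length G S (g [^]\<^bsub>G\<^esub> n))" using K(1) by (simp add: field_simps)
    qed
    thus ?thesis unfolding uniformly_undistorted_def using \<delta>(1) K(1) by (intro exI[of _ "\<delta> / K"]) auto
  qed
  moreover have "\<exists>A. quasi_axis G X d \<phi> \<epsilon> g A" if g: "infinite_order G g" and \<epsilon>: "0 < \<epsilon>" for g \<epsilon>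
  proof -
    have gG: "g \<in> carrier G" using g by (simp add: infinite_order_def)
    have \<tau>: "0 < \<tau> g" using \<delta>_le[OF g] \<delta>(1) by linarith
    hence "\<tau> g < \<tau> g + min \<epsilon> (\<epsilon> * \<tau> g)" using \<epsilon> by simp
    then obtain y where y: "y \<in> X" "d y (\<phi> g y) < \<tau> g + min \<epsilon> (\<epsilon> * \<tau> g)"
      unfolding \<tau>_def using x0 by (subst (asm) cINF_less_iff) (auto intro: bdd_belowI2[where m = 0])
    have L: "0 < d y (\<phi> g y)" using \<tau>_le[OF y(1), of g] \<tau> by linarith
    obtain f where f: "range f \<subseteq> X" "\<And>s t. d (f s) (f t) \<le> \<bar>s - t\<bar>"
      "\<And>(k::int) t. \<phi> (g [^]\<^bsub>G\<^esub> k) (f t) = f (t + real_of_int k * d y (\<phi> g y))"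
      using periodic_path[OF inj gG y(1) L] by blast
    have "quasi_axis G X d \<phi> \<epsilon> g (range f)"
      by (rule periodic_path_quasi_axis[OF gG \<epsilon> f linear[OF gG] L \<tau>_le[OF y(1)]])
        (use y in \<open>auto simp: algebra_simps\<close>)
    thus ?thesis ..
  qed
  ultimately show ?thesis by blast
qed

end
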